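(* For every integer $k\ge 1$ and every real $a>0$, $$\zeta(k+1,a)=\Gamma(a)\sum_{n=k}^{\infty}\begin{bmatrix} n\\ k\end{bmatrix}\frac{1}{n\,\Gamma(n+a)},$$ which for $a=1$ becomes $\zeta(k+1)=\sum_{n=k}^{\infty}\begin{bmatrix} n\\ k\end{bmatrix}\frac{1}{n!\,n}$.
   Context: $\begin{bmatrix} n\\ k\end{bmatrix}$ denotes the unsigned Stirling numbers of the first kind, defined by $x(x+1)\cdots(x+n-1)=\sum_{k=0}^{n}\begin{bmatrix} n\\ k\end{bmatrix}x^k$. The Hurwitz zeta function is $\zeta(s,a)=\sum_{n=0}^{\infty}\frac{1}{(n+a)^s}$ for $\operatorname{Re}(s)>1$, $a>0$; $\zeta(s)=\zeta(s,1)$ is the Riemann zeta function. $\Gamma$ is the gamma function. *)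

theory Defs
  imports "HOL-Analysis.Analysis" "HOL-Combinatorics.Stirling"
begin

text \<open>
  The unsigned Stirling numbers of the first kind are the library's \<^const>\<open>stirling\<close>
  (lower case); the fact \<open>stirling_pochhammer\<close> identifies them as the coefficients of
  \<open>x (x + 1) \<cdots> (x + n - 1)\<close>.

  The series below represents the Hurwitz zeta function only for \<open>Re s > 1\<close> and \<open>a > 0\<close>;
  no analytic continuation is built in, so other arguments carry no meaning.
\<close>

definition hurwitz_zeta :: "complex \<Rightarrow> real \<Rightarrow> complex" where
  "hurwitz_zeta s a = (\<Sum>n. 1 / (of_nat n + of_real a) powr s)"

definition riemann_zeta :: "complex \<Rightarrow> complex" where
  "riemann_zeta s = hurwitz_zeta s 1"

lemma summable_hurwitz_zeta:
  fixes s :: complex and a :: real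
  assumes "Re s > 1" and "a > 0"
  shows "summable (\<lambda>n. 1 / (of_nat n + of_real a) powr s)"
proof (rule summable_comparison_test'[where N = 1])
  show "summable (\<lambda>n. real n powr - Re s)"
    using assms by (simp add: summable_real_powr_iff)
next
  fix n :: nat
  assume n: "n \<ge> 1"
  have "norm (1 / (of_nat n + of_real a) powr s) = (real n + a) powr - Re s"
  proof -
    have "norm ((complex_of_real (real n + a)) powr s) = (real n + a) powr Re s"
      using assms by (subst norm_powr_real_powr) auto
    then show ?thesis
      by (simp add: norm_divide powr_minus_divide)
  qed
  also have "\<dots> \<le> real n powr - Re s"
    using assms n by (intro powr_mono2') auto
  finally show "norm (1 / (of_nat n + of_real a) powr s) \<le> real n powr - Re s" .
qed

end

theory Submission
  imports Defs
begin

text \<open>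
  Write \<open>(a)\<^sub>n = a (a + 1) \<cdots> (a + n - 1)\<close> and let \<open>s(n, k)\<close> be the unsigned Stirling numbers of
  the first kind. Since \<open>\<Gamma>(a) / \<Gamma>(n + a) = 1 / (a)\<^sub>n\<close>, the claim is
  \<open>\<zeta>(k + 1, a) = \<Sum>\<^sub>n s(n, k) / (n (a)\<^sub>n)\<close>. Both sides are the two iterated sums of one
  nonnegative double series,
  \<open>\<Sum>\<^sub>m \<Sum>\<^sub>n s(n, k) / (a + m)\<^bsub>n+1\<^esub>\<close>.

  Summing over \<open>n\<close> first gives \<open>\<Sum>\<^sub>m 1 / (a + m)\<^bsup>k+1\<^esup>\<close>, because the Stirling numbers are the
  coefficients that expand a power of \<open>1 / x\<close> in inverse rising factorials
  (\<open>stirling_inverse_pochhammer_sums\<close>).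
  Summing over \<open>m\<close> first gives \<open>s(n, k) / (n (a)\<^sub>n)\<close>, because
  \<open>1 / (n (x)\<^sub>n) - 1 / (n (x + 1)\<^sub>n) = 1 / (x)\<^bsub>n+1\<^esub>\<close> telescopes along \<open>x = a + m\<close>
  (\<open>inverse_pochhammer_shift_sums\<close>).
  Nonnegativity of all terms makes the exchange of the two summations legitimate, and the
  convergence of the zeta series then yields the convergence of the Stirling series.
\<close>

text \<open>
  A positive \<open>L\<close> would force \<open>u n / (a + n)\<close> to dominate a multiple of the harmonic series.
  This excludes a positive limit of a sequence that is so far only known to converge.
\<close>

lemma summable_div_add_imp_limit_nonpos:
  fixes u :: "nat \<Rightarrow> real"
  assumes a: "a > 0" and sm: "summable (\<lambda>n. u n / (a + real n))" and lim: "u \<longlonglongrightarrow> L"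
  shows "L \<le> 0"
proof (rule ccontr)
  assume "\<not> L \<le> 0"
  hence L: "L > 0" by simp
  have "eventually (\<lambda>n. u n > L / 2) sequentially"
    using lim L by (intro order_tendstoD(1)) auto
  moreover have "eventually (\<lambda>n. real n \<ge> a) sequentially"
    by real_asymp
  ultimately have "eventually (\<lambda>n. norm (inverse (real n)) \<le> 4 / L * (u n / (a + real n))) sequentially"
  proof eventually_elim
    case (elim n)
    have n: "real n > 0" using elim a by linarith
    have "inverse (real n) = 4 / L * ((L / 2) / (2 * real n))"
      using L n by (simp add: field_simps)
    also have "\<dots> \<le> 4 / L * (u n / (a + real n))"
      using elim L a n by (intro mult_left_mono frac_le) auto
    finally show ?case using n by simp
  qed
  hence "summable (\<lambda>n. inverse (real n))"
    by (rule summable_comparison_test_ev) (intro summable_mult sm)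
  thus False using not_summable_harmonic[where 'a = real] by simp
qed

text \<open>
  The recurrence for Stirling numbers makes
  \<open>(s(n, k) - a s(n, k + 1)) / (a)\<^bsub>n+1\<^esub>\<close> the increment of \<open>s(n, k + 1) / (a)\<^sub>n\<close>, so the sum for
  \<open>k + 1\<close> is \<open>1 / a\<close> times the sum for \<open>k\<close>, up to the boundary term \<open>s(n, k + 1) / (a)\<^sub>n\<close>.
  That term is nonnegative, hence bounds the partial sums; once the series for \<open>k + 1\<close> is known to
  converge, the boundary term converges too, and its limit must vanish.
\<close>

lemma stirling_inverse_pochhammer_sums:
  fixes a :: real
  assumes a: "a > 0"
  shows "(\<lambda>n. real (stirling n k) / pochhammer a (Suc n)) sums (1 / a ^ (k + 1))"
proof (induction k)
  case 0
  have "(\<lambda>n. real (stirling n 0) / pochhammer a (Suc n)) sums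
          (\<Sum>n\<in>{0}. real (stirling n 0) / pochhammer a (Suc n))"
    by (rule sums_finite) auto
  thus ?case by simp
next
  case (Suc k)
  define u where "u = (\<lambda>n. real (stirling n k) / pochhammer a (Suc n))"
  define v where "v = (\<lambda>n. real (stirling n (Suc k)) / pochhammer a (Suc n))"
  define c where "c = (\<lambda>n. real (stirling n (Suc k)) / pochhammer a n)"
  have pos: "pochhammer a n > 0" for n using a by (rule pochhammer_pos)
  have u0: "u n \<ge> 0" and v0: "v n \<ge> 0" and c0: "c n \<ge> 0" for n
    using pos[of n] pos[of "Suc n"] by (simp_all add: u_def v_def c_def)
  have u: "u sums (1 / a ^ (k + 1))" using Suc.IH by (simp add: u_def)
  have step: "c (Suc n) - c n = u n - a * v n" for n
    using pos[of n] a
    by (simp add: c_def u_def v_def pochhammer_Suc divide_simps add_pos_nonneg less_imp_neq[symmetric])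
       (simp add: algebra_simps)
  have part: "c n = (\<Sum>i<n. u i) - a * (\<Sum>i<n. v i)" for n
  proof -
    have "(\<Sum>i<n. u i - a * v i) = c n - c 0"
      unfolding step[symmetric] by (rule sum_lessThan_telescope)
    thus ?thesis by (simp add: c_def sum_subtractf sum_distrib_left)
  qed
  have "summable v"
  proof (rule summableI_nonneg_bounded)
    fix n
    have "a * (\<Sum>i<n. v i) \<le> (\<Sum>i<n. u i)" using part[of n] c0[of n] by simp
    also have "\<dots> \<le> 1 / a ^ (k + 1)"
      using sum_le_suminf[of u "{..<n}"] u u0 by (auto simp: sums_iff)
    finally show "(\<Sum>i<n. v i) \<le> 1 / a ^ (k + 1) / a"
      using a by (simp add: field_simps)
  qed (rule v0)
  hence v: "v sums suminf v" by (rule summable_sums)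
  have c: "c \<longlonglongrightarrow> 1 / a ^ (k + 1) - a * suminf v"
    unfolding part[abs_def] using u v unfolding sums_def by (intro tendsto_intros)
  moreover have "summable (\<lambda>n. c n / (a + real n))"
    using \<open>summable v\<close> by (simp add: c_def v_def pochhammer_Suc)
  ultimately have "1 / a ^ (k + 1) - a * suminf v \<le> 0"
    using a by (intro summable_div_add_imp_limit_nonpos)
  moreover have "1 / a ^ (k + 1) - a * suminf v \<ge> 0"
    using c c0 by (intro LIMSEQ_le_const) auto
  ultimately have "suminf v = 1 / a ^ (Suc k + 1)"
    using a by (simp add: field_simps)
  thus ?case using v by (simp add: v_def)
qed

text \<open>
  The two products \<open>(x)\<^sub>n\<close> and \<open>(x + 1)\<^sub>n\<close> share all but their outermost factors \<open>x\<close> and \<open>x + n\<close>,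
  which differ by \<open>n\<close>; this is why the difference of their reciprocals, divided by \<open>n\<close>, is
  exactly \<open>1 / (x)\<^bsub>n+1\<^esub>\<close>.
\<close>

lemma inverse_pochhammer_shift_sums:
  fixes a :: real
  assumes a: "a > 0" and n: "n > 0"
  shows "(\<lambda>m. 1 / pochhammer (a + real m) (Suc n)) sums (1 / (real n * pochhammer a n))"
proof -
  define f where "f = (\<lambda>m. 1 / (real n * pochhammer (a + real m) n))"
  obtain p where p: "n = Suc p" using n gr0_implies_Suc by blast
  have step: "f m - f (Suc m) = 1 / pochhammer (a + real m) (Suc n)" for m
  proof -
    define x where "x = a + real m"
    define P where "P = pochhammer (x + 1) p"
    have x: "x > 0" using a by (simp add: x_def)
    have P: "P > 0" using x by (auto simp: P_def intro!: pochhammer_pos)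
    have 1: "pochhammer x n = x * P" by (simp add: p P_def pochhammer_rec)
    have 2: "pochhammer (x + 1) n = P * (x + real n)"
      by (simp add: p P_def pochhammer_Suc add_ac)
    have 3: "pochhammer x (Suc n) = x * P * (x + real n)"
      by (simp add: pochhammer_rec[of x n] 2)
    have fm: "f m = 1 / (real n * (x * P))"
      using 1 by (simp add: f_def x_def)
    have fS: "f (Suc m) = 1 / (real n * (P * (x + real n)))"
      using 2 by (simp add: f_def x_def add_ac)
    have "x + real n > 0" using x by simp
    thus ?thesis unfolding x_def[symmetric] 3 fm fS
      using x P n by (simp add: divide_simps)
  qed
  have "f \<longlonglongrightarrow> 0"
  proof (rule tendsto_sandwich)
    show "eventually (\<lambda>m. 0 \<le> f m) sequentially"
      using a by (intro always_eventually allI) (auto simp: f_def intro!: mult_nonneg_nonneg pochhammer_nonneg)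
    show "eventually (\<lambda>m. f m \<le> 1 / (a + real m)) sequentially"
      using eventually_ge_at_top[of "1 :: nat"]
    proof eventually_elim
      case (elim m)
      define x where "x = a + real m"
      have x: "x > 1" using a elim by (simp add: x_def)
      have "1 \<le> pochhammer (x + 1) p"
        using x by (auto simp: pochhammer_prod intro!: prod_ge_1)
      hence "x * 1 \<le> pochhammer x n"
        unfolding p pochhammer_rec using x by (intro mult_left_mono) auto
      moreover have "1 * pochhammer x n \<le> real n * pochhammer x n"
        using n x by (intro mult_right_mono pochhammer_nonneg) auto
      ultimately have "x \<le> real n * pochhammer x n" by simp
      thus ?case using x by (simp add: f_def x_def[symmetric] frac_le)
    qed
    show "(\<lambda>m. 1 / (a + real m)) \<longlonglongrightarrow> 0" by real_asymp
  qed simp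
  from telescope_sums'[OF this] show ?thesis
    unfolding step by (simp add: f_def)
qed

text \<open>
  Both iterated sums of \<open>s(n, k) / (a + m)\<^bsub>n+1\<^esub>\<close> are known; convergence of the zeta series gives
  summability over pairs, which transfers to the other order of summation.
\<close>

lemma stirling_pochhammer_series_sums:
  fixes a Z :: real
  assumes a: "a > 0" and k: "k \<ge> 1"
    and Z: "(\<lambda>m. 1 / (real m + a) ^ (k + 1)) sums Z"
  shows "(\<lambda>n. real (stirling n k) / (real n * pochhammer a n)) sums Z"
proof -
  define F where "F = (\<lambda>(m, n). real (stirling n k) / pochhammer (a + real m) (Suc n))"
  have F0: "F (m, n) \<ge> 0" for m n
    using a by (auto simp: F_def intro!: divide_nonneg_nonneg pochhammer_nonneg)
  have inner_n: "((\<lambda>n. F (m, n)) has_sum (1 / (real m + a) ^ (k + 1))) UNIV" for m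
  proof (rule sums_nonneg_imp_has_sum)
    show "(\<lambda>n. F (m, n)) sums (1 / (real m + a) ^ (k + 1))"
      using stirling_inverse_pochhammer_sums[of "a + real m" k] a
      by (simp add: F_def add_ac)
  qed (rule F0)
  have inner_m: "((\<lambda>m. F (m, n)) has_sum
                   (real (stirling n k) / (real n * pochhammer a n))) UNIV" for n
  proof (rule sums_nonneg_imp_has_sum)
    show "(\<lambda>m. F (m, n)) sums (real (stirling n k) / (real n * pochhammer a n))"
    proof (cases "n = 0")
      case True
      \<comment> \<open>The numerator \<open>s(0, k)\<close> vanishes for \<open>k \<ge> 1\<close>, so the quotient by \<open>n = 0\<close> is harmless.\<close>
      thus ?thesis using k by (simp add: F_def)
    next
      case False
      thus ?thesis
        using sums_mult[OF inverse_pochhammer_shift_sums[OF a], of n "real (stirling n k)"]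
        by (simp add: F_def)
    qed
  qed (rule F0)
  have outer: "((\<lambda>m. 1 / (real m + a) ^ (k + 1)) has_sum Z) UNIV"
    using Z by (rule sums_nonneg_imp_has_sum) (use a in auto)
  hence "F summable_on (UNIV \<times> UNIV)"
    using inner_n F0
    by (intro summable_on_SigmaI[where g = "\<lambda>m. 1 / (real m + a) ^ (k + 1)"])
       (auto simp: summable_on_def)
  hence "(F has_sum Z) (UNIV \<times> UNIV)"
    using inner_n outer by (intro has_sum_SigmaI) auto
  hence "((\<lambda>(n, m). F (m, n)) has_sum Z) (UNIV \<times> UNIV)"
    by (subst (asm) has_sum_swap)
  hence "((\<lambda>n. real (stirling n k) / (real n * pochhammer a n)) has_sum Z) UNIV"
    using inner_m by (intro has_sum_SigmaD[where g = "\<lambda>n. real (stirling n k) / (real n * pochhammer a n)"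
          and f = "\<lambda>(n, m). F (m, n)" and B = "\<lambda>_. UNIV"]) auto
  thus ?thesis by (rule has_sum_imp_sums)
qed

lemma hurwitz_zeta_real_sums:
  fixes a :: real
  assumes a: "a > 0" and k: "k \<ge> 1"
  obtains Z where "(\<lambda>m. 1 / (real m + a) ^ (k + 1)) sums Z"
    and "hurwitz_zeta (of_nat (k + 1)) a = complex_of_real Z"
proof -
  have eq: "1 / (of_nat m + complex_of_real a) powr of_nat (k + 1)
              = complex_of_real (1 / (real m + a) ^ (k + 1))" for m
    by (subst powr_nat') auto
  have "summable (\<lambda>m. complex_of_real (1 / (real m + a) ^ (k + 1)))"
    using summable_hurwitz_zeta[of "of_nat (k + 1)" a] a k unfolding eq by simp
  hence sm: "summable (\<lambda>m. 1 / (real m + a) ^ (k + 1))"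
    by (simp only: summable_complex_of_real)
  show ?thesis
  proof (rule that[OF summable_sums[OF sm]])
    show "hurwitz_zeta (of_nat (k + 1)) a = complex_of_real (\<Sum>m. 1 / (real m + a) ^ (k + 1))"
      unfolding hurwitz_zeta_def eq using sm by (rule suminf_of_real[symmetric])
  qed
qed

lemma hurwitz_zeta_stirling_sums:
  fixes a :: real
  assumes a: "a > 0" and k: "k \<ge> 1"
  obtains Z where "hurwitz_zeta (of_nat (k + 1)) a = complex_of_real (Gamma a * Z)"
    and "(\<lambda>n. real (stirling (n + k) k) / (real (n + k) * Gamma (real (n + k) + a))) sums Z"
proof -
  obtain Z where Z: "(\<lambda>m. 1 / (real m + a) ^ (k + 1)) sums Z"
    and zeta: "hurwitz_zeta (of_nat (k + 1)) a = complex_of_real Z"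
    using hurwitz_zeta_real_sums[OF a k] .
  have G: "Gamma a > 0" using a by (rule Gamma_real_pos)
  have poch: "pochhammer a n = Gamma (real n + a) / Gamma a" for n
    using a by (subst pochhammer_Gamma) (auto simp: add_ac elim!: nonpos_Ints_cases)
  have "(\<lambda>n. real (stirling n k) / (real n * pochhammer a n) / Gamma a) sums (Z / Gamma a)"
    by (intro sums_divide stirling_pochhammer_series_sums a k Z)
  hence "(\<lambda>n. real (stirling n k) / (real n * Gamma (real n + a))) sums (Z / Gamma a)"
    using G by (simp add: poch field_simps)
  hence "(\<lambda>n. real (stirling (n + k) k) / (real (n + k) * Gamma (real (n + k) + a)))
           sums (Z / Gamma a)"
    by (subst sums_zero_iff_shift) auto
  thus ?thesis using that[of "Z / Gamma a"] zeta G by simp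
qed

theorem proposition1:
  fixes k :: nat and a :: real
  assumes "k \<ge> 1" and "a > 0"
  shows "summable (\<lambda>n. real (stirling (n + k) k) / (real (n + k) * Gamma (real (n + k) + a)))
      \<and> hurwitz_zeta (of_nat (k + 1)) a =
           complex_of_real (Gamma a *
             (\<Sum>n. real (stirling (n + k) k) / (real (n + k) * Gamma (real (n + k) + a))))
      \<and> summable (\<lambda>n. real (stirling (n + k) k) / (fact (n + k) * real (n + k)))
      \<and> riemann_zeta (of_nat (k + 1)) =
           complex_of_real (\<Sum>n. real (stirling (n + k) k) / (fact (n + k) * real (n + k)))"
proof -
  obtain Z where Z: "hurwitz_zeta (of_nat (k + 1)) a = complex_of_real (Gamma a * Z)"
    "(\<lambda>n. real (stirling (n + k) k) / (real (n + k) * Gamma (real (n + k) + a))) sums Z"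
    using hurwitz_zeta_stirling_sums[OF assms(2,1)] .
  obtain R where R: "hurwitz_zeta (of_nat (k + 1)) 1 = complex_of_real (Gamma 1 * R)"
    "(\<lambda>n. real (stirling (n + k) k) / (real (n + k) * Gamma (real (n + k) + 1))) sums R"
    using hurwitz_zeta_stirling_sums[OF zero_less_one assms(1)] .
  have "Gamma (real n + 1) = fact n" for n
    using Gamma_fact[of n, where 'a = real] by (simp add: add_ac)
  hence R': "(\<lambda>n. real (stirling (n + k) k) / (fact (n + k) * real (n + k))) sums R"
    using R(2) by (simp only: mult.commute)
  show ?thesis
    using Z R(1) R' by (simp add: riemann_zeta_def sums_iff)
qed

end
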